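(* Let $x_0,x_1,x_2,\ldots$ be i.i.d. integer random variables uniformly distributed on $[1,k]$, i.e. on $\{1,\ldots,k\}$. Put $y_i:=|x_i-x_{i-1}|$ for $i\ge1$, $M:=\mathbb{E}(y_i)=\frac{(k-1)(k+1)}{3k}$, $Q_m:=\sum_{i=1}^{m}y_i$, and $\sigma:=\sqrt{V^*}$ with $$V^*:=\frac{(k-1)(k+1)(k^2+1)}{15k^2}.$$ Then $$\frac{Q_m-mM}{\sigma\sqrt{m}}\sim\mathcal{N}(0,1),\qquad m\to\infty,$$ that is, the left-hand side is asymptotically (in distribution) a standard Gaussian random variable.
   Context: $\mathcal{N}(0,1)$ denotes a Gaussian (normal) random variable with mean $0$ and variance $1$. The constant $V^*$ is the coefficient of $n$ in the dominant term of the variance of the perimeter $\sum_{i=1}^{n-1}y_i+x_0+x_{n-1}+2n$ of the word $x_0x_1\cdots x_{n-1}$. *)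

theory Defs
  imports "HOL-Probability.Probability"
begin

text \<open>The absolute difference of neighbouring letters, meant for \<open>i \<ge> 1\<close> only
  (the natural-number subtraction makes it \<open>0\<close> at \<open>i = 0\<close>).\<close>
definition gap :: "(nat \<Rightarrow> 'a \<Rightarrow> int) \<Rightarrow> nat \<Rightarrow> 'a \<Rightarrow> real" where
  "gap x i \<omega> = real_of_int \<bar>x i \<omega> - x (i - 1) \<omega>\<bar>"

definition gap_sum :: "(nat \<Rightarrow> 'a \<Rightarrow> int) \<Rightarrow> nat \<Rightarrow> 'a \<Rightarrow> real" where
  "gap_sum x m \<omega> = (\<Sum>i=1..m. gap x i \<omega>)"

text \<open>The coefficient of \<open>n\<close> in the dominant term of the variance of the perimeter
  \<open>gap_sum x (n - 1) + x 0 + x (n - 1) + 2 * n\<close>. It vanishes for \<open>k = 1\<close>.\<close>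
definition Vstar :: "nat \<Rightarrow> real" where
  "Vstar k = (real k - 1) * (real k + 1) * ((real k)\<^sup>2 + 1) / (15 * (real k)\<^sup>2)"

end

(* Let g(a) = E|a - X| - M and h(a,b) = |a - b| - M + g(b) - g(a).  Then E h(a,X) = 0 for every
   letter a, and Q_m - m M differs from S_m = h(x_0,x_1) + ... + h(x_{m-1},x_m) only by the bounded
   term g(x_0) - g(x_m), so it suffices to treat the martingale S_m.  Put v(a) = E h(a,X)^2 and
   V = E v(X).  The transfer operator f |-> E exp(i s h(.,X)) f(X) sends the function
   1 - s^2 (v - V) / 2 to 1 - s^2 V / 2 times itself, up to an error O(s^3).  Conditioning on the
   past one letter at a time therefore gives E exp(i s S_m) = (1 - s^2 V / 2)^m + O(m s^3 + s^2),
   and s = t / sqrt (V m) with Levy's continuity theorem yields the normal limit.  Finally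
   V = Vstar k by summing over the k^2 pairs of letters. *)

theory Submission
  imports Defs "HOL-Real_Asymp.Real_Asymp"
begin

section \<open>Independent identically distributed letters: integrating out the next one\<close>

locale iid_process = prob_space P for P :: "'a measure" +
  fixes N D :: "'b measure" and X :: "nat \<Rightarrow> 'a \<Rightarrow> 'b"
  assumes indep: "indep_vars (\<lambda>_. N) X UNIV"
    and law: "distr P N (X i) = D"
begin

lemma measurable_X [measurable]: "X i \<in> measurable P N"
  using indep by (auto simp: indep_vars_def)

lemma sets_D [measurable_cong, simp]: "sets D = sets N"
  by (subst law[of 0, symmetric]) simp

lemma space_D [simp]: "space D = space N"
  by (rule sets_eq_imp_space_eq) simp

lemma prob_space_D: "prob_space D"
  by (subst law[of 0, symmetric]) (rule prob_space_distr, simp)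

lemma integral_X:
  fixes f :: "'b \<Rightarrow> 'c::{banach, second_countable_topology}"
  assumes "f \<in> borel_measurable N"
  shows "(\<integral>\<omega>. f (X i \<omega>) \<partial>P) = (\<integral>b. f b \<partial>D)"
  by (subst law[of i, symmetric]) (rule integral_distr[symmetric], use assms in auto)

text \<open>Disjoint blocks of an independent family are independent, so the blocks
  \<open>{..m}\<close> and \<open>{Suc m}\<close> have a product law. Evaluating the one-point block
  at \<open>Suc m\<close> turns its law into \<open>D\<close>.\<close>

lemma past_next_distr:
  "distr P (PiM {..m} (\<lambda>_. N) \<Otimes>\<^sub>M N) (\<lambda>\<omega>. (\<lambda>i\<in>{..m}. X i \<omega>, X (Suc m) \<omega>)) =
   distr P (PiM {..m} (\<lambda>_. N)) (\<lambda>\<omega>. \<lambda>i\<in>{..m}. X i \<omega>) \<Otimes>\<^sub>M D"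
proof -
  let ?U = "PiM {..m} (\<lambda>_. N)" and ?W = "PiM {Suc m} (\<lambda>_. N)"
  let ?Y = "\<lambda>\<omega>. \<lambda>i\<in>{..m}. X i \<omega>" and ?Z = "\<lambda>\<omega>. \<lambda>i\<in>{Suc m}. X i \<omega>"
  have Y: "?Y \<in> measurable P ?U" and Z: "?Z \<in> measurable P ?W"
    by measurable
  have Zm: "(\<lambda>u. u (Suc m)) \<in> measurable ?W N"
    by measurable
  have ind: "distr P ?U ?Y \<Otimes>\<^sub>M distr P ?W ?Z = distr P (?U \<Otimes>\<^sub>M ?W) (\<lambda>\<omega>. (?Y \<omega>, ?Z \<omega>))"
    using indep_var_restrict[OF indep, of "{..m}" "{Suc m}"]
    unfolding indep_var_distribution_eq by auto
  have D: "distr (distr P ?W ?Z) N (\<lambda>u. u (Suc m)) = D"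
    using Z Zm by (simp add: distr_distr comp_def law)
  have "distr P ?U ?Y \<Otimes>\<^sub>M D =
      distr (distr P ?U ?Y) ?U (\<lambda>u. u) \<Otimes>\<^sub>M distr (distr P ?W ?Z) N (\<lambda>u. u (Suc m))"
    unfolding D by (simp add: distr_id2)
  also have "\<dots> = distr (distr P ?U ?Y \<Otimes>\<^sub>M distr P ?W ?Z) (?U \<Otimes>\<^sub>M N) (\<lambda>(u, w). (u, w (Suc m)))"
    by (rule pair_measure_distr)
      (use Zm prob_space_D in \<open>auto simp: D intro: prob_space_imp_sigma_finite\<close>)
  also have "\<dots> = distr P (?U \<Otimes>\<^sub>M N) (\<lambda>\<omega>. (?Y \<omega>, X (Suc m) \<omega>))"
    unfolding ind using Y Z Zm by (subst distr_distr) (auto simp: comp_def)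
  finally show ?thesis ..
qed

text \<open>This is conditioning on the letters up to index \<open>m\<close>, done by Fubini on the
  product law of \<open>past_next_distr\<close> instead of conditional expectations. The bound on
  \<open>F\<close> supplies integrability.\<close>

lemma expectation_next:
  fixes F :: "(nat \<Rightarrow> 'b) \<Rightarrow> 'b \<Rightarrow> 'd::{banach, second_countable_topology}"
  assumes F: "case_prod F \<in> borel_measurable (PiM {..m} (\<lambda>_. N) \<Otimes>\<^sub>M N)"
    and bnd: "\<And>u b. u \<in> space (PiM {..m} (\<lambda>_. N)) \<Longrightarrow> b \<in> space N \<Longrightarrow> norm (F u b) \<le> C"
  shows "(\<integral>\<omega>. F (\<lambda>i\<in>{..m}. X i \<omega>) (X (Suc m) \<omega>) \<partial>P) =
    (\<integral>\<omega>. (\<integral>b. F (\<lambda>i\<in>{..m}. X i \<omega>) b \<partial>D) \<partial>P)"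
proof -
  let ?U = "PiM {..m} (\<lambda>_. N)" and ?Y = "\<lambda>\<omega>. \<lambda>i\<in>{..m}. X i \<omega>"
  have Y: "?Y \<in> measurable P ?U"
    by measurable
  interpret D: prob_space D by (rule prob_space_D)
  interpret Y: prob_space "distr P ?U ?Y" by (rule prob_space_distr[OF Y])
  interpret DY: pair_prob_space "distr P ?U ?Y" D ..
  have F': "case_prod F \<in> borel_measurable (distr P ?U ?Y \<Otimes>\<^sub>M D)"
    using F by measurable
  have "(\<integral>\<omega>. F (?Y \<omega>) (X (Suc m) \<omega>) \<partial>P) = (\<integral>p. case_prod F p \<partial>(distr P ?U ?Y \<Otimes>\<^sub>M D))"
    unfolding past_next_distr[symmetric] by (subst integral_distr) (use Y F in auto)
  also have "\<dots> = (\<integral>u. (\<integral>b. F u b \<partial>D) \<partial>distr P ?U ?Y)"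
  proof (rule DY.integral_fst'[of "case_prod F", simplified, symmetric])
    show "integrable (distr P ?U ?Y \<Otimes>\<^sub>M D) (\<lambda>(x, y). F x y)"
      by (rule DY.P.integrable_const_bound[where B=C])
        (use F' bnd in \<open>auto simp: space_pair_measure intro!: AE_I2\<close>)
  qed
  also have "\<dots> = (\<integral>\<omega>. (\<integral>b. F (?Y \<omega>) b \<partial>D) \<partial>P)"
    by (rule integral_distr[OF Y]) (use F in measurable)
  finally show ?thesis .
qed

text \<open>The case in which \<open>F\<close> sees only the last letter \<open>u m\<close> of the
  past. It serves to compute the mean of a single gap.\<close>

lemma expectation_pair:
  fixes F :: "'b \<Rightarrow> 'b \<Rightarrow> 'd::{banach, second_countable_topology}"
  assumes [measurable]: "case_prod F \<in> borel_measurable (N \<Otimes>\<^sub>M N)"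
    and bnd: "\<And>a b. a \<in> space N \<Longrightarrow> b \<in> space N \<Longrightarrow> norm (F a b) \<le> C"
  shows "(\<integral>\<omega>. F (X m \<omega>) (X (Suc m) \<omega>) \<partial>P) = (\<integral>a. (\<integral>b. F a b \<partial>D) \<partial>D)"
proof -
  interpret D: prob_space D by (rule prob_space_D)
  have "(\<integral>\<omega>. F (X m \<omega>) (X (Suc m) \<omega>) \<partial>P) = (\<integral>\<omega>. (\<integral>b. F (X m \<omega>) b \<partial>D) \<partial>P)"
    using expectation_next[where F="\<lambda>u. F (u m)" and m=m and C=C]
    by (auto intro!: bnd simp: space_PiM)
  also have "\<dots> = (\<integral>a. (\<integral>b. F a b \<partial>D) \<partial>D)"
    by (rule integral_X) measurable
  finally show ?thesis .
qed

end

section \<open>Central limit theorem for sums of a bounded centred kernel\<close>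

locale centred_kernel = iid_process +
  fixes h :: "'b \<Rightarrow> 'b \<Rightarrow> real" and B :: real
  assumes kernel_measurable [measurable]: "case_prod h \<in> borel_measurable (N \<Otimes>\<^sub>M N)"
    and kernel_bounded: "\<bar>h a b\<bar> \<le> B"
    and kernel_centred: "(\<integral>b. h a b \<partial>D) = 0"
begin

sublocale D: prob_space D by (rule prob_space_D)

lemma measure_D_space [simp]: "measure D (space N) = 1"
  using D.prob_space by simp

definition kernel_sum :: "nat \<Rightarrow> 'a \<Rightarrow> real" where
  "kernel_sum m \<omega> = (\<Sum>i=1..m. h (X (i - 1) \<omega>) (X i \<omega>))"

definition cond_var :: "'b \<Rightarrow> real" where
  "cond_var a = (\<integral>b. (h a b)\<^sup>2 \<partial>D)"

text \<open>Centring makes the increments of \<open>kernel_sum\<close> orthogonal, so this is the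
  variance of \<open>kernel_sum m\<close> per step.\<close>

definition kernel_var :: real where
  "kernel_var = (\<integral>a. cond_var a \<partial>D)"

text \<open>At \<open>s = 0\<close> the transfer operator is integration against \<open>D\<close>,
  with eigenvalue 1 and eigenfunction 1. Moving the eigenvalue to
  \<open>1 - s\<^sup>2 * kernel_var / 2\<close> and matching terms of order two forces this
  corrector up to a constant, which is chosen so that \<open>eigenfn s\<close> has mean 1 under
  \<open>D\<close>.\<close>

definition eigenfn :: "real \<Rightarrow> 'b \<Rightarrow> real" where
  "eigenfn s a = 1 - s\<^sup>2 / 2 * (cond_var a - kernel_var)"

lemma B_nonneg: "0 \<le> B"
  using kernel_bounded[of undefined undefined] by simp

lemma measurable_cond_var [measurable]: "cond_var \<in> borel_measurable N"
  unfolding cond_var_def by measurable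

lemma measurable_eigenfn [measurable]: "eigenfn s \<in> borel_measurable N"
  unfolding eigenfn_def by measurable

lemma measurable_kernel_sum [measurable]: "kernel_sum m \<in> borel_measurable P"
  unfolding kernel_sum_def by measurable

lemma kernel_square_le: "(h a b)\<^sup>2 \<le> B\<^sup>2"
  using kernel_bounded by (rule abs_le_square_iff[THEN iffD1, OF order_trans]) simp

lemma integrable_h: "a \<in> space N \<Longrightarrow> integrable D (h a)"
  by (rule D.integrable_const_bound[where B=B]) (use kernel_bounded in auto)

lemma integrable_h2: "a \<in> space N \<Longrightarrow> integrable D (\<lambda>b. (h a b)\<^sup>2)"
  by (rule D.integrable_const_bound[where B="B\<^sup>2"]) (use kernel_square_le in auto)

lemma cond_var_bounds: "a \<in> space N \<Longrightarrow> 0 \<le> cond_var a \<and> cond_var a \<le> B\<^sup>2"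
  unfolding cond_var_def using kernel_square_le
  by (auto intro!: Bochner_Integration.integral_nonneg D.integral_le_const integrable_h2)

lemma integrable_cond_var: "integrable D cond_var"
  by (rule D.integrable_const_bound[where B="B\<^sup>2"])
    (use cond_var_bounds in auto)

lemma kernel_var_bounds: "0 \<le> kernel_var \<and> kernel_var \<le> B\<^sup>2"
  unfolding kernel_var_def using cond_var_bounds
  by (auto intro!: Bochner_Integration.integral_nonneg D.integral_le_const integrable_cond_var)

lemma abs_cond_var_minus_kernel_var_le: "a \<in> space N \<Longrightarrow> \<bar>cond_var a - kernel_var\<bar> \<le> B\<^sup>2"
  using cond_var_bounds[of a] kernel_var_bounds by auto

lemma eigenfn_bound:
  assumes "a \<in> space N" "\<bar>s\<bar> * B \<le> 1"
  shows "\<bar>eigenfn s a - 1\<bar> \<le> (\<bar>s\<bar> * B)\<^sup>2 / 2" and "\<bar>eigenfn s a\<bar> \<le> 2"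
proof -
  have "\<bar>eigenfn s a - 1\<bar> = s\<^sup>2 / 2 * \<bar>cond_var a - kernel_var\<bar>"
    by (simp add: eigenfn_def abs_mult)
  also have "\<dots> \<le> s\<^sup>2 / 2 * B\<^sup>2"
    by (intro mult_left_mono abs_cond_var_minus_kernel_var_le assms) simp
  finally show *: "\<bar>eigenfn s a - 1\<bar> \<le> (\<bar>s\<bar> * B)\<^sup>2 / 2"
    by (simp add: power_mult_distrib)
  have "(\<bar>s\<bar> * B)\<^sup>2 \<le> 1"
    using assms B_nonneg by (intro power_le_one) auto
  with * show "\<bar>eigenfn s a\<bar> \<le> 2" by linarith
qed

text \<open>To second order, the linear term integrates to 0 by centring and so does the corrector
  inside the integral. What remains is \<open>1 - s\<^sup>2 / 2 * cond_var a\<close>, whose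
  dependence on \<open>a\<close> is exactly what the corrector at \<open>a\<close> on the other side
  reproduces.\<close>

lemma approx_eigenfunction:
  assumes a: "a \<in> space N" and s: "\<bar>s\<bar> * B \<le> 1"
  shows "cmod ((\<integral>b. iexp (s * h a b) * eigenfn s b \<partial>D) - (1 - s\<^sup>2 * kernel_var / 2) * eigenfn s a) \<le> (\<bar>s\<bar> * B) ^ 3"
proof -
  \<comment> \<open>The Taylor polynomial of degree two in \<open>s\<close> of the integrand, with
    real and imaginary parts kept apart so that each becomes a real integral.\<close>
  define q where "q b = complex_of_real (1 - s\<^sup>2 / 2 * ((h a b)\<^sup>2 + (cond_var b - kernel_var))) + \<i> * complex_of_real (s * h a b)" for b
  have int_real: "integrable D (\<lambda>b. 1 - s\<^sup>2 / 2 * ((h a b)\<^sup>2 + (cond_var b - kernel_var)))"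
    using integrable_h2[OF a] integrable_cond_var by auto
  have int_imag: "integrable D (\<lambda>b. s * h a b)"
    using integrable_h[OF a] by simp
  have int_q: "integrable D q"
    unfolding q_def using int_real int_imag
    by (intro Bochner_Integration.integrable_add integrable_mult_right) (auto simp del: of_real_mult of_real_diff of_real_add simp: integrable_of_real)
  have "(\<integral>b. q b \<partial>D) = complex_of_real (\<integral>b. 1 - s\<^sup>2 / 2 * ((h a b)\<^sup>2 + (cond_var b - kernel_var)) \<partial>D)
      + \<i> * complex_of_real (\<integral>b. s * h a b \<partial>D)"
    unfolding q_def using int_real int_imag
    by (subst Bochner_Integration.integral_add)
      (auto simp del: of_real_mult of_real_diff of_real_add simp: integrable_of_real)
  also have "(\<integral>b. 1 - s\<^sup>2 / 2 * ((h a b)\<^sup>2 + (cond_var b - kernel_var)) \<partial>D) = 1 - s\<^sup>2 / 2 * cond_var a"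
    using integrable_h2[OF a] integrable_cond_var
    by (simp add: cond_var_def[of a] kernel_var_def)
  also have "(\<integral>b. s * h a b \<partial>D) = 0"
    by (simp add: kernel_centred)
  finally have q: "(\<integral>b. q b \<partial>D) = complex_of_real (1 - s\<^sup>2 / 2 * cond_var a)" by simp
  have int: "integrable D (\<lambda>b. iexp (s * h a b) * eigenfn s b)"
    by (rule D.integrable_const_bound[where B=2])
      (use eigenfn_bound(2)[OF _ s] a in \<open>auto simp: norm_mult\<close>)
  have pw: "cmod (iexp (s * h a b) * eigenfn s b - q b) \<le> 2 / 3 * (\<bar>s\<bar> * B) ^ 3" if b: "b \<in> space N" for b
  proof -
    let ?e = "iexp (s * h a b)"
    have sh: "\<bar>s * h a b\<bar> \<le> \<bar>s\<bar> * B"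
      using kernel_bounded[of a b] by (simp add: abs_mult mult_left_mono)
    have e1: "cmod (?e - 1) \<le> \<bar>s * h a b\<bar>"
      using iexp_approx1[of "s * h a b" 0] by simp
    have e2: "cmod (?e - (1 + \<i> * (s * h a b) - (s * h a b)\<^sup>2 / 2)) \<le> \<bar>s * h a b\<bar> ^ 3 / 6"
      using iexp_approx1[of "s * h a b" 2]
      by (simp add: numeral_eq_Suc power_mult_distrib algebra_simps)
    define w where "w = complex_of_real (s\<^sup>2 / 2 * (cond_var b - kernel_var))"
    have fw: "complex_of_real (eigenfn s b) = 1 - w"
      by (simp add: eigenfn_def w_def)
    have qw: "q b = 1 + \<i> * (s * h a b) - (s * h a b)\<^sup>2 / 2 - w"
      by (simp add: q_def w_def field_simps)
    \<comment> \<open>Both pieces are of order three: the Taylor remainder of the exponential, and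
      the corrector (order two) times \<open>?e - 1\<close> (order one). They contribute 1/6 and
      1/2, hence the 2/3.\<close>
    have "?e * eigenfn s b - q b = (?e - (1 + \<i> * (s * h a b) - (s * h a b)\<^sup>2 / 2))
        - complex_of_real (s\<^sup>2 / 2 * (cond_var b - kernel_var)) * (?e - 1)"
      unfolding fw qw w_def[symmetric] by (simp add: algebra_simps)
    also have "cmod \<dots> \<le> cmod (?e - (1 + \<i> * (s * h a b) - (s * h a b)\<^sup>2 / 2))
        + cmod (complex_of_real (s\<^sup>2 / 2 * (cond_var b - kernel_var)) * (?e - 1))"
      by (rule norm_triangle_ineq4)
    also have "\<dots> \<le> \<bar>s * h a b\<bar> ^ 3 / 6 + (s\<^sup>2 / 2 * B\<^sup>2) * \<bar>s * h a b\<bar>"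
      unfolding norm_mult norm_of_real abs_mult
      by (intro add_mono mult_mono) (use e1 e2 abs_cond_var_minus_kernel_var_le[OF b] in \<open>auto simp: abs_mult\<close>)
    also have "\<dots> \<le> (\<bar>s\<bar> * B) ^ 3 / 6 + (s\<^sup>2 / 2 * B\<^sup>2) * (\<bar>s\<bar> * B)"
      using sh by (intro add_mono divide_right_mono power_mono mult_left_mono) auto
    also have "\<dots> = 2 / 3 * (\<bar>s\<bar> * B) ^ 3"
      by (simp add: power3_eq_cube power2_eq_square)
    finally show ?thesis .
  qed
  \<comment> \<open>The two occurrences of \<open>kernel_var\<close> cancel at order two, leaving
    only a term of order four.\<close>
  have "(1 - s\<^sup>2 * kernel_var / 2) * eigenfn s a = 1 - s\<^sup>2 / 2 * cond_var a + s ^ 4 * kernel_var * (cond_var a - kernel_var) / 4"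
    by (simp add: eigenfn_def field_simps power2_eq_square power4_eq_xxxx)
  then have "complex_of_real ((1 - s\<^sup>2 * kernel_var / 2) * eigenfn s a) =
      complex_of_real (1 - s\<^sup>2 / 2 * cond_var a) + complex_of_real (s ^ 4 * kernel_var * (cond_var a - kernel_var) / 4)"
    by (simp only: of_real_add)
  then have "(\<integral>b. iexp (s * h a b) * eigenfn s b \<partial>D) - (1 - s\<^sup>2 * kernel_var / 2) * eigenfn s a =
      (\<integral>b. iexp (s * h a b) * eigenfn s b - q b \<partial>D) - complex_of_real (s ^ 4 * kernel_var * (cond_var a - kernel_var) / 4)"
    by (subst Bochner_Integration.integral_diff[OF int int_q])
      (simp add: q)
  also have "cmod \<dots> \<le> cmod (\<integral>b. iexp (s * h a b) * eigenfn s b - q b \<partial>D)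
      + cmod (complex_of_real (s ^ 4 * kernel_var * (cond_var a - kernel_var) / 4))"
    by (rule norm_triangle_ineq4)
  \<comment> \<open>The 1/4 comes from the term of order four, where one of the four factors
    \<open>\<bar>s\<bar> * B\<close> is estimated by 1. As 2/3 + 1/4 < 1, the final constant is
    1.\<close>
  also have "\<dots> \<le> 2 / 3 * (\<bar>s\<bar> * B) ^ 3 + (\<bar>s\<bar> * B) ^ 3 / 4"
  proof (rule add_mono)
    have "cmod (\<integral>b. iexp (s * h a b) * eigenfn s b - q b \<partial>D) \<le> (\<integral>b. cmod (iexp (s * h a b) * eigenfn s b - q b) \<partial>D)"
      by (rule integral_norm_bound)
    also have "\<dots> \<le> 2 / 3 * (\<bar>s\<bar> * B) ^ 3"
      by (rule D.integral_le_const) (use int int_q pw in auto)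
    finally show "cmod (\<integral>b. iexp (s * h a b) * eigenfn s b - q b \<partial>D) \<le> 2 / 3 * (\<bar>s\<bar> * B) ^ 3" .
    have "cmod (complex_of_real (s ^ 4 * kernel_var * (cond_var a - kernel_var) / 4)) = s ^ 4 * kernel_var * \<bar>cond_var a - kernel_var\<bar> / 4"
      unfolding norm_of_real using kernel_var_bounds by (simp add: abs_mult)
    also have "\<dots> \<le> s ^ 4 * B\<^sup>2 * B\<^sup>2 / 4"
      using kernel_var_bounds abs_cond_var_minus_kernel_var_le[OF a] by (intro divide_right_mono mult_mono) auto
    also have "\<dots> = (\<bar>s\<bar> * B) * (\<bar>s\<bar> * B) ^ 3 / 4"
      by (subst power_even_abs[symmetric]) (simp_all add: power_mult_distrib numeral_eq_Suc)
    also have "\<dots> \<le> 1 * (\<bar>s\<bar> * B) ^ 3 / 4"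
      using s B_nonneg by (intro divide_right_mono mult_right_mono) auto
    finally show "cmod (complex_of_real (s ^ 4 * kernel_var * (cond_var a - kernel_var) / 4)) \<le> (\<bar>s\<bar> * B) ^ 3 / 4" by simp
  qed
  also have "\<dots> \<le> (\<bar>s\<bar> * B) ^ 3"
    using B_nonneg by simp
  finally show ?thesis .
qed

lemma integrable_iexp_eigenfn:
  assumes "\<bar>s\<bar> * B \<le> 1"
  shows "integrable P (\<lambda>\<omega>. iexp (s * kernel_sum m \<omega>) * eigenfn s (X m \<omega>))"
  by (rule integrable_const_bound[where B=2])
    (use eigenfn_bound(2)[OF _ assms] measurable_space[OF measurable_X] in \<open>auto simp: norm_mult\<close>)

text \<open>Given the past, the new increment depends only on \<open>X m\<close>, so integrating out
  \<open>X (Suc m)\<close> applies the transfer operator to \<open>eigenfn s\<close> at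
  \<open>X m\<close>. The exponential of the earlier sum has modulus one and does not enlarge the
  error.\<close>

lemma char_step:
  assumes s: "\<bar>s\<bar> * B \<le> 1"
  shows "cmod ((\<integral>\<omega>. iexp (s * kernel_sum (Suc m) \<omega>) * eigenfn s (X (Suc m) \<omega>) \<partial>P)
    - (1 - s\<^sup>2 * kernel_var / 2) * (\<integral>\<omega>. iexp (s * kernel_sum m \<omega>) * eigenfn s (X m \<omega>) \<partial>P)) \<le> (\<bar>s\<bar> * B) ^ 3"
proof -
  let ?U = "PiM {..m} (\<lambda>_. N)" and ?Y = "\<lambda>\<omega>. \<lambda>i\<in>{..m}. X i \<omega>"
  \<comment> \<open>\<open>kernel_sum m\<close> as a function of the path, the form that
    \<open>expectation_next\<close> asks for.\<close>
  define T where "T u = (\<Sum>i=1..m. h (u (i - 1)) (u i))" for u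
  define A where "A a = (\<integral>b. iexp (s * h a b) * eigenfn s b \<partial>D)" for a
  have [measurable]: "A \<in> borel_measurable N"
    unfolding A_def by measurable
  have proj: "(\<lambda>u. u i) \<in> measurable ?U N" if "i \<le> m" for i
    using that by (auto intro: measurable_component_singleton)
  have summand: "(\<lambda>u. h (u (i - 1)) (u i)) \<in> borel_measurable ?U" if "i \<le> m" for i
    using measurable_compose[OF measurable_Pair[OF proj[of "i - 1"] proj[of i]] kernel_measurable] that by simp
  have [measurable]: "T \<in> borel_measurable ?U"
    unfolding T_def by (intro borel_measurable_sum summand) simp
  have [measurable]: "(\<lambda>u. u m) \<in> measurable ?U N"
    by (rule proj) simp
  have T: "T (?Y \<omega>) = kernel_sum m \<omega>" for \<omega>
    unfolding T_def kernel_sum_def by (intro sum.cong) auto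
  define F where "F u b = iexp (s * T u) * (iexp (s * h (u m) b) * eigenfn s b)" for u b
  have "(\<integral>\<omega>. iexp (s * kernel_sum (Suc m) \<omega>) * eigenfn s (X (Suc m) \<omega>) \<partial>P) = (\<integral>\<omega>. F (?Y \<omega>) (X (Suc m) \<omega>) \<partial>P)"
    unfolding F_def T by (simp add: kernel_sum_def distrib_left exp_add mult.assoc)
  also have "\<dots> = (\<integral>\<omega>. (\<integral>b. F (?Y \<omega>) b \<partial>D) \<partial>P)"
  proof (rule expectation_next)
    show "case_prod F \<in> borel_measurable (?U \<Otimes>\<^sub>M N)"
      unfolding F_def by measurable
    show "norm (F u b) \<le> 2" if "b \<in> space N" for u b
      unfolding F_def using eigenfn_bound(2)[OF that s] by (simp add: norm_mult)
  qed
  also have "\<dots> = (\<integral>\<omega>. iexp (s * kernel_sum m \<omega>) * A (X m \<omega>) \<partial>P)"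
    unfolding F_def T A_def by simp
  finally have eq: "(\<integral>\<omega>. iexp (s * kernel_sum (Suc m) \<omega>) * eigenfn s (X (Suc m) \<omega>) \<partial>P) =
    (\<integral>\<omega>. iexp (s * kernel_sum m \<omega>) * A (X m \<omega>) \<partial>P)" .
  have A: "cmod (A a - (1 - s\<^sup>2 * kernel_var / 2) * eigenfn s a) \<le> (\<bar>s\<bar> * B) ^ 3" if "a \<in> space N" for a
    unfolding A_def by (rule approx_eigenfunction[OF that s])
  let ?R = "\<lambda>\<omega>. iexp (s * kernel_sum m \<omega>) * (A (X m \<omega>) - (1 - s\<^sup>2 * kernel_var / 2) * eigenfn s (X m \<omega>))"
  have R: "cmod (?R \<omega>) \<le> (\<bar>s\<bar> * B) ^ 3" if "\<omega> \<in> space P" for \<omega>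
    using A[OF measurable_space[OF measurable_X that]] by (simp add: norm_mult)
  have intR: "integrable P ?R"
    by (rule integrable_const_bound[where B="(\<bar>s\<bar> * B) ^ 3"]) (use R in auto)
  have int0: "integrable P (\<lambda>\<omega>. (1 - s\<^sup>2 * kernel_var / 2) * (iexp (s * kernel_sum m \<omega>) * eigenfn s (X m \<omega>)))"
    by (intro integrable_mult_right integrable_iexp_eigenfn s)
  have "(\<integral>\<omega>. iexp (s * kernel_sum m \<omega>) * A (X m \<omega>) \<partial>P) =
      (\<integral>\<omega>. ?R \<omega> + (1 - s\<^sup>2 * kernel_var / 2) * (iexp (s * kernel_sum m \<omega>) * eigenfn s (X m \<omega>)) \<partial>P)"
    by (simp add: algebra_simps)
  also have "\<dots> = (\<integral>\<omega>. ?R \<omega> \<partial>P) + (1 - s\<^sup>2 * kernel_var / 2) * (\<integral>\<omega>. iexp (s * kernel_sum m \<omega>) * eigenfn s (X m \<omega>) \<partial>P)"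
    using Bochner_Integration.integral_add[OF intR int0] by simp
  finally have "cmod ((\<integral>\<omega>. iexp (s * kernel_sum (Suc m) \<omega>) * eigenfn s (X (Suc m) \<omega>) \<partial>P)
    - (1 - s\<^sup>2 * kernel_var / 2) * (\<integral>\<omega>. iexp (s * kernel_sum m \<omega>) * eigenfn s (X m \<omega>) \<partial>P)) = cmod (\<integral>\<omega>. ?R \<omega> \<partial>P)"
    unfolding eq by simp
  also have "\<dots> \<le> (\<integral>\<omega>. cmod (?R \<omega>) \<partial>P)"
    by (rule integral_norm_bound)
  also have "\<dots> \<le> (\<bar>s\<bar> * B) ^ 3"
    by (rule integral_le_const) (use intR R in auto)
  finally show ?thesis .
qed

text \<open>The errors of single steps add up without being amplified, because the eigenvalue has
  modulus at most 1. There is no error at \<open>m = 0\<close>, since \<open>eigenfn s\<close> has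
  mean 1.\<close>

lemma char_approx:
  assumes s: "\<bar>s\<bar> * B \<le> 1"
  shows "cmod ((\<integral>\<omega>. iexp (s * kernel_sum m \<omega>) * eigenfn s (X m \<omega>) \<partial>P) - complex_of_real ((1 - s\<^sup>2 * kernel_var / 2) ^ m))
    \<le> m * (\<bar>s\<bar> * B) ^ 3"
proof (induction m)
  case 0
  have "(\<integral>\<omega>. eigenfn s (X 0 \<omega>) \<partial>P) = 1"
    unfolding integral_X[OF measurable_eigenfn] by (simp add: eigenfn_def[abs_def] integrable_cond_var kernel_var_def)
  then show ?case by (simp add: kernel_sum_def)
next
  case (Suc m)
  let ?W = "\<lambda>m. \<integral>\<omega>. iexp (s * kernel_sum m \<omega>) * eigenfn s (X m \<omega>) \<partial>P"
  let ?l = "1 - s\<^sup>2 * kernel_var / 2"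
  have "s\<^sup>2 * kernel_var \<le> s\<^sup>2 * B\<^sup>2"
    using kernel_var_bounds by (intro mult_left_mono) auto
  also have "\<dots> = (\<bar>s\<bar> * B)\<^sup>2"
    by (simp add: power_mult_distrib)
  also have "\<dots> \<le> 1"
    using s B_nonneg by (intro power_le_one) auto
  finally have l: "\<bar>?l\<bar> \<le> 1"
    using kernel_var_bounds by (auto simp: abs_le_iff)
  \<comment> \<open>The error of the last step, plus the eigenvalue times the error accumulated
    before.\<close>
  have split: "?W (Suc m) - complex_of_real (?l ^ Suc m) =
      (?W (Suc m) - ?l * ?W m) + complex_of_real ?l * (?W m - complex_of_real (?l ^ m))"
    by (simp add: algebra_simps)
  have "cmod (?W (Suc m) - complex_of_real (?l ^ Suc m)) \<le>
      cmod (?W (Suc m) - ?l * ?W m) + cmod (complex_of_real ?l * (?W m - complex_of_real (?l ^ m)))"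
    unfolding split by (rule norm_triangle_ineq)
  also have "\<dots> \<le> (\<bar>s\<bar> * B) ^ 3 + 1 * (m * (\<bar>s\<bar> * B) ^ 3)"
    unfolding norm_mult norm_of_real
    by (rule add_mono[OF char_step[OF s] mult_mono[OF l Suc.IH]]) simp_all
  finally show ?case by (simp add: algebra_simps)
qed

text \<open>The corrector is dropped only once, at the end, so its deviation from 1, of order two in
  \<open>s\<close>, is not multiplied by \<open>m\<close>.\<close>

lemma char_kernel_sum_bound:
  assumes s: "\<bar>s\<bar> * B \<le> 1"
  shows "cmod ((\<integral>\<omega>. iexp (s * kernel_sum m \<omega>) \<partial>P) - complex_of_real ((1 - s\<^sup>2 * kernel_var / 2) ^ m))
    \<le> m * (\<bar>s\<bar> * B) ^ 3 + (\<bar>s\<bar> * B)\<^sup>2 / 2"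
proof -
  let ?d = "\<lambda>\<omega>. iexp (s * kernel_sum m \<omega>) - iexp (s * kernel_sum m \<omega>) * eigenfn s (X m \<omega>)"
  have int: "integrable P (\<lambda>\<omega>. iexp (s * kernel_sum m \<omega>))"
    by (rule integrable_const_bound[where B=1]) auto
  have d: "cmod (?d \<omega>) \<le> (\<bar>s\<bar> * B)\<^sup>2 / 2" if "\<omega> \<in> space P" for \<omega>
  proof -
    have "?d \<omega> = iexp (s * kernel_sum m \<omega>) * complex_of_real (1 - eigenfn s (X m \<omega>))"
      by (simp add: algebra_simps)
    then have "cmod (?d \<omega>) = \<bar>eigenfn s (X m \<omega>) - 1\<bar>"
      by (simp add: norm_mult abs_minus_commute del: of_real_diff)
    then show ?thesis
      using eigenfn_bound(1)[OF measurable_space[OF measurable_X that] s] by simp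
  qed
  have "cmod (\<integral>\<omega>. ?d \<omega> \<partial>P) \<le> (\<integral>\<omega>. cmod (?d \<omega>) \<partial>P)"
    by (rule integral_norm_bound)
  also have "\<dots> \<le> (\<bar>s\<bar> * B)\<^sup>2 / 2"
    by (rule integral_le_const) (use int integrable_iexp_eigenfn[OF s] d in auto)
  finally have "cmod ((\<integral>\<omega>. iexp (s * kernel_sum m \<omega>) \<partial>P) - (\<integral>\<omega>. iexp (s * kernel_sum m \<omega>) * eigenfn s (X m \<omega>) \<partial>P)) \<le> (\<bar>s\<bar> * B)\<^sup>2 / 2"
    by (subst (asm) Bochner_Integration.integral_diff[OF int integrable_iexp_eigenfn[OF s]])
  from norm_diff_triangle_le[OF this char_approx[OF s, of m]] show ?thesis
    by (simp add: add.commute)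
qed

text \<open>For fixed \<open>t\<close> the argument \<open>s\<close> is of order 1 / sqrt m, so the
  accumulated error of order m s^3 still vanishes. A deviation of at most \<open>C\<close> from the
  martingale moves the characteristic function by at most \<open>\<bar>s\<bar> * C\<close>, which
  vanishes too.\<close>

theorem clt_up_to_bounded_error:
  fixes Q :: "nat \<Rightarrow> 'a \<Rightarrow> real"
  assumes kernel_var_pos: "kernel_var > 0"
    and Q [measurable]: "\<And>m. Q m \<in> borel_measurable P"
    and close: "\<And>m. AE \<omega> in P. \<bar>Q m \<omega> - kernel_sum m \<omega>\<bar> \<le> C"
  shows "weak_conv_m (\<lambda>m. distr P borel (\<lambda>\<omega>. Q m \<omega> / (sqrt kernel_var * sqrt m))) std_normal_distribution"
proof (rule levy_continuity)
  show "real_distribution (distr P borel (\<lambda>\<omega>. Q m \<omega> / (sqrt kernel_var * sqrt (real m))))" for m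
    by (rule real_distribution_distr) simp
  show "real_distribution std_normal_distribution"
    by (rule real_dist_normal_dist)
  fix t :: real
  define s where "s m = t / (sqrt kernel_var * sqrt (real m))" for m :: nat
  define c where "c = \<bar>t\<bar> / sqrt kernel_var * B"
  have c: "\<bar>s m\<bar> * B = c / sqrt (real m)" for m
    using kernel_var_pos by (simp add: s_def c_def abs_mult)
  have s0: "s \<longlonglongrightarrow> 0"
  proof -
    have "(\<lambda>m. d / sqrt (real m)) \<longlonglongrightarrow> 0" for d :: real
      by real_asymp
    from this[of "t / sqrt kernel_var"] show ?thesis by (simp add: s_def[abs_def])
  qed
  have char_Q: "char (distr P borel (\<lambda>\<omega>. Q m \<omega> / (sqrt kernel_var * sqrt (real m)))) t = (\<integral>\<omega>. iexp (s m * Q m \<omega>) \<partial>P)" for m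
    unfolding char_def s_def by (subst integral_distr) auto
  have QS: "cmod ((\<integral>\<omega>. iexp (s m * Q m \<omega>) \<partial>P) - (\<integral>\<omega>. iexp (s m * kernel_sum m \<omega>) \<partial>P)) \<le> \<bar>s m\<bar> * C" for m
  proof -
    have int: "integrable P (\<lambda>\<omega>. iexp (s m * kernel_sum m \<omega>))" "integrable P (\<lambda>\<omega>. iexp (s m * Q m \<omega>))"
      by (rule integrable_const_bound[where B=1]; simp)+
    have d: "cmod (iexp (s m * Q m \<omega>) - iexp (s m * kernel_sum m \<omega>)) \<le> \<bar>s m\<bar> * C" if "\<bar>Q m \<omega> - kernel_sum m \<omega>\<bar> \<le> C" for \<omega>
    proof -
      \<comment> \<open>Taking out a factor of modulus one reduces the claim to |exp(i y) - 1| \<le>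
        |y|.\<close>
      have "iexp (s m * Q m \<omega>) - iexp (s m * kernel_sum m \<omega>) =
          iexp (s m * kernel_sum m \<omega>) * (iexp (s m * (Q m \<omega> - kernel_sum m \<omega>)) - 1)"
        by (simp add: algebra_simps flip: exp_add)
      also have "cmod \<dots> \<le> \<bar>s m * (Q m \<omega> - kernel_sum m \<omega>)\<bar>"
        using iexp_approx1[of "s m * (Q m \<omega> - kernel_sum m \<omega>)" 0] by (simp add: norm_mult)
      also have "\<dots> \<le> \<bar>s m\<bar> * C"
        using that by (simp add: abs_mult mult_left_mono)
      finally show ?thesis .
    qed
    have "cmod (\<integral>\<omega>. iexp (s m * Q m \<omega>) - iexp (s m * kernel_sum m \<omega>) \<partial>P) \<le> (\<integral>\<omega>. cmod (iexp (s m * Q m \<omega>) - iexp (s m * kernel_sum m \<omega>)) \<partial>P)"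
      by (rule integral_norm_bound)
    also have "\<dots> \<le> \<bar>s m\<bar> * C"
      by (rule integral_le_const) (use int d close[of m] in auto)
    finally show ?thesis using int by simp
  qed
  let ?b = "\<lambda>m. \<bar>s m\<bar> * C + (m * (c / sqrt (real m)) ^ 3 + (c / sqrt (real m))\<^sup>2 / 2)"
  \<comment> \<open>The smallness condition of \<open>char_kernel_sum_bound\<close>, rewritten
    through \<open>c\<close>, holds for all large \<open>m\<close>.\<close>
  have "eventually (\<lambda>m. c / sqrt (real m) \<le> 1) sequentially"
    by real_asymp
  then have ev: "eventually (\<lambda>m. cmod ((\<integral>\<omega>. iexp (s m * Q m \<omega>) \<partial>P)
      - complex_of_real ((1 + (- (t\<^sup>2 / 2)) / m) ^ m)) \<le> ?b m) sequentially"
    using eventually_gt_at_top[of 0]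
  proof eventually_elim
    case (elim m)
    \<comment> \<open>The scaling is chosen so that the power of the eigenvalue becomes (1 - t^2 /
      (2 m))^m, with limit exp(-t^2 / 2).\<close>
    have "(s m)\<^sup>2 * kernel_var = t\<^sup>2 / m"
      using kernel_var_pos elim by (simp add: s_def power_divide power_mult_distrib)
    then have l: "1 - (s m)\<^sup>2 * kernel_var / 2 = 1 + (- (t\<^sup>2 / 2)) / m" by simp
    show ?case
      using norm_diff_triangle_le[OF QS[of m] char_kernel_sum_bound[of "s m" m]] elim unfolding c l by simp
  qed
  have b0: "?b \<longlonglongrightarrow> 0"
  proof -
    have "(\<lambda>m. \<bar>s m\<bar> * C) \<longlonglongrightarrow> 0"
      using s0 by (intro tendsto_mult_left_zero tendsto_rabs_zero)
    moreover have "(\<lambda>m. m * (c / sqrt (real m)) ^ 3 + (c / sqrt (real m))\<^sup>2 / 2) \<longlonglongrightarrow> 0"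
    proof -
      have "(\<lambda>m. real m * (1 / sqrt (real m)) ^ 3) \<longlonglongrightarrow> 0" "(\<lambda>m. (1 / sqrt (real m))\<^sup>2 / 2) \<longlonglongrightarrow> 0"
        by real_asymp+
      then have "(\<lambda>m. c ^ 3 * (real m * (1 / sqrt (real m)) ^ 3) + c\<^sup>2 * ((1 / sqrt (real m))\<^sup>2 / 2)) \<longlonglongrightarrow> 0"
        by (intro tendsto_add_zero tendsto_mult_right_zero)
      then show ?thesis by (simp add: power_divide mult.commute)
    qed
    ultimately show ?thesis by (rule tendsto_add_zero)
  qed
  have "(\<lambda>m. complex_of_real ((1 + (- (t\<^sup>2 / 2)) / m) ^ m)) \<longlonglongrightarrow> complex_of_real (exp (- (t\<^sup>2 / 2)))"
    by (intro tendsto_of_real tendsto_exp_limit_sequentially)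
  then have "(\<lambda>m. \<integral>\<omega>. iexp (s m * Q m \<omega>) \<partial>P) \<longlonglongrightarrow> complex_of_real (exp (- (t\<^sup>2 / 2)))"
    by (rule Lim_transform) (rule Lim_null_comparison[OF ev b0])
  then show "(\<lambda>m. char (distr P borel (\<lambda>\<omega>. Q m \<omega> / (sqrt kernel_var * sqrt (real m)))) t)
      \<longlonglongrightarrow> char std_normal_distribution t"
    by (simp add: char_Q char_std_normal_distribution)
qed

end

section \<open>Power sums and the variance constant\<close>

lemma sum_real_powers:
  "(\<Sum>i=1..n. real i) = real n * (real n + 1) / 2"
  "(\<Sum>i=1..n. (real i)\<^sup>2) = real n * (real n + 1) * (2 * real n + 1) / 6"
  "(\<Sum>i=1..n. real i ^ 3) = (real n * (real n + 1) / 2)\<^sup>2"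
  "(\<Sum>i=1..n. real i ^ 4) =
    real n * (real n + 1) * (2 * real n + 1) * (3 * (real n)\<^sup>2 + 3 * real n - 1) / 30"
  by (induction n; simp add: field_simps power2_eq_square power3_eq_cube power4_eq_xxxx)+

text \<open>The induction starts at \<open>n = a\<close>, where every difference is nonnegative;
  each later letter \<open>Suc n\<close> adds \<open>Suc n - a\<close>.\<close>

lemma sum_abs_diff:
  assumes "a \<le> n"
  shows "(\<Sum>b=1..n. \<bar>real a - real b\<bar>) =
    (real a)\<^sup>2 - (real n + 1) * real a + real n * (real n + 1) / 2"
  using assms
proof (induction n rule: nat_induct_at_least)
  case base
  have "(\<Sum>b=1..a. \<bar>real a - real b\<bar>) = (\<Sum>b=1..a. real a - real b)"
    by (intro sum.cong) auto
  then show ?case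
    unfolding sum_subtractf sum_real_powers by (simp add: power2_eq_square field_simps)
next
  case (Suc n)
  then show ?case
    by (simp add: field_simps)
qed

text \<open>At a letter \<open>a\<close> this is the mean distance to a uniform letter. The closed
  form is a quadratic in \<open>a\<close>, so power sums can evaluate its sums.\<close>

definition mean_dist :: "nat \<Rightarrow> real \<Rightarrow> real" where
  "mean_dist k a = (a\<^sup>2 - (real k + 1) * a + real k * (real k + 1) / 2) / real k"

lemma sum_abs_diff_mean_dist:
  assumes "a \<in> {1..k}"
  shows "(\<Sum>b=1..k. \<bar>real a - real b\<bar>) = real k * mean_dist k (real a)"
  using assms by (subst sum_abs_diff) (auto simp: mean_dist_def)

definition mean_gap :: "nat \<Rightarrow> real" where
  "mean_gap k = (real k - 1) * (real k + 1) / (3 * real k)"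

lemma sum_mean_dist:
  assumes "k > 0"
  shows "(\<Sum>a=1..k. mean_dist k (real a)) = real k * mean_gap k"
proof -
  have "(\<Sum>a=1..k. mean_dist k (real a)) =
      (\<Sum>a=1..k. (real a)\<^sup>2 - (real k + 1) * real a + real k * (real k + 1) / 2) / real k"
    by (simp add: mean_dist_def sum_divide_distrib)
  also have "\<dots> = real k * mean_gap k"
    using assms unfolding sum.distrib sum_subtractf sum_distrib_left[symmetric] sum_real_powers
    by (simp add: mean_gap_def field_simps power2_eq_square)
  finally show ?thesis .
qed

lemma sum_sum_abs_diff:
  assumes "k > 0"
  shows "(\<Sum>a=1..k. \<Sum>b=1..k. \<bar>real a - real b\<bar>) = (real k)\<^sup>2 * mean_gap k"
proof -
  have "(\<Sum>a=1..k. \<Sum>b=1..k. \<bar>real a - real b\<bar>) = (\<Sum>a=1..k. real k * mean_dist k (real a))"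
    by (intro sum.cong refl sum_abs_diff_mean_dist)
  also have "\<dots> = (real k)\<^sup>2 * mean_gap k"
    unfolding sum_distrib_left[symmetric] sum_mean_dist[OF assms] by (simp add: power2_eq_square)
  finally show ?thesis .
qed

text \<open>Squaring the quadratic gives degree four, which is why power sums up to the fourth are
  at hand.\<close>

lemma sum_mean_dist_square:
  assumes "k > 0"
  shows "(\<Sum>a=1..k. (mean_dist k (real a))\<^sup>2) =
    ((real k)\<^sup>2 - 1) * (7 * (real k)\<^sup>2 - 8) / (60 * real k)"
proof -
  let ?K = "real k"
  have "(mean_dist k a)\<^sup>2 = (a ^ 4 - 2 * (?K + 1) * a ^ 3 + (?K + 1) * (2 * ?K + 1) * a\<^sup>2
      - ?K * (?K + 1)\<^sup>2 * a + ?K\<^sup>2 * (?K + 1)\<^sup>2 / 4) / ?K\<^sup>2" for a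
    by (simp add: mean_dist_def power_divide) (simp add: field_simps power2_eq_square power3_eq_cube power4_eq_xxxx)
  then have "(\<Sum>a=1..k. (mean_dist k (real a))\<^sup>2) =
      (\<Sum>a=1..k. real a ^ 4 - 2 * (?K + 1) * real a ^ 3 + (?K + 1) * (2 * ?K + 1) * (real a)\<^sup>2
      - ?K * (?K + 1)\<^sup>2 * real a + ?K\<^sup>2 * (?K + 1)\<^sup>2 / 4) / ?K\<^sup>2"
    by (simp add: sum_divide_distrib)
  also have "\<dots> = (?K\<^sup>2 - 1) * (7 * ?K\<^sup>2 - 8) / (60 * ?K)"
    using assms unfolding sum.distrib sum_subtractf sum_distrib_left[symmetric] sum_real_powers
    by (simp add: field_simps power2_eq_square power3_eq_cube power4_eq_xxxx)
  finally show ?thesis .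
qed

text \<open>Expand the square. Summing a distance over one letter yields
  \<open>real k * mean_dist\<close> at the other, so every mixed term reduces to sums of
  \<open>mean_dist\<close> and of its square.\<close>

lemma variance_double_sum:
  assumes "k > 0"
  shows "(\<Sum>a=1..k. \<Sum>b=1..k. (\<bar>real a - real b\<bar> - mean_gap k + mean_dist k (real b) - mean_dist k (real a))\<^sup>2)
    = (real k)\<^sup>2 * Vstar k"
proof -
  let ?K = "real k" and ?u = "\<lambda>a. mean_dist k (real a)" and ?M = "mean_gap k"
  have "(\<Sum>a=1..k. \<Sum>b=1..k. \<bar>real a - real b\<bar> * ?u a) = (\<Sum>a=1..k. ?K * (?u a)\<^sup>2)"
  proof (intro sum.cong refl)
    fix a assume "a \<in> {1..k}"
    then show "(\<Sum>b=1..k. \<bar>real a - real b\<bar> * ?u a) = ?K * (?u a)\<^sup>2"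
      unfolding sum_distrib_right[symmetric] by (subst sum_abs_diff_mean_dist) (simp_all add: power2_eq_square)
  qed
  then have cross_a: "(\<Sum>a=1..k. \<Sum>b=1..k. \<bar>real a - real b\<bar> * ?u a) = ?K * (\<Sum>a=1..k. (?u a)\<^sup>2)"
    by (simp only: sum_distrib_left)
  have cross_b: "(\<Sum>a=1..k. \<Sum>b=1..k. \<bar>real a - real b\<bar> * ?u b) = ?K * (\<Sum>a=1..k. (?u a)\<^sup>2)"
  proof -
    have "(\<Sum>a=1..k. \<Sum>b=1..k. \<bar>real a - real b\<bar> * ?u b) = (\<Sum>b=1..k. \<Sum>a=1..k. \<bar>real a - real b\<bar> * ?u b)"
      by (rule sum.swap)
    also have "\<dots> = (\<Sum>b=1..k. \<Sum>a=1..k. \<bar>real b - real a\<bar> * ?u b)"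
      by (intro sum.cong refl arg_cong2[where f="(*)"] abs_minus_commute)
    finally show ?thesis unfolding cross_a .
  qed
  have sq: "(\<Sum>a=1..k. \<Sum>b=1..k. (real a - real b)\<^sup>2) =
      2 * ?K * (\<Sum>a=1..k. (real a)\<^sup>2) - 2 * (\<Sum>a=1..k. real a)\<^sup>2"
  proof -
    have "(\<Sum>a=1..k. \<Sum>b=1..k. (real a - real b)\<^sup>2) =
        (\<Sum>a=1..k. \<Sum>b=1..k. (real a)\<^sup>2 + (real b)\<^sup>2 - 2 * (real a * real b))"
      by (simp add: power2_diff mult.assoc)
    also have "\<dots> = ?K * (\<Sum>a=1..k. (real a)\<^sup>2) + ?K * (\<Sum>b=1..k. (real b)\<^sup>2)
        - 2 * (\<Sum>a=1..k. \<Sum>b=1..k. real a * real b)"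
      unfolding sum.distrib sum_subtractf sum_distrib_left[symmetric] by (simp add: sum_distrib_left)
    also have "(\<Sum>a=1..k. \<Sum>b=1..k. real a * real b) = (\<Sum>a=1..k. real a)\<^sup>2"
      unfolding power2_eq_square by (rule sum_product[symmetric])
    finally show ?thesis by simp
  qed
  have "(\<bar>x\<bar> - m + p - q)\<^sup>2 = x\<^sup>2 - 2 * m * \<bar>x\<bar> + m\<^sup>2 + 2 * (\<bar>x\<bar> * p) - 2 * (\<bar>x\<bar> * q)
      - 2 * m * p + 2 * m * q + p\<^sup>2 + q\<^sup>2 - 2 * (q * p)" for x m p q :: real
    by (subst power2_abs[symmetric, of x]) (simp add: power2_eq_square algebra_simps)
  then have "(\<Sum>a=1..k. \<Sum>b=1..k. (\<bar>real a - real b\<bar> - ?M + ?u b - ?u a)\<^sup>2) =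
     (\<Sum>a=1..k. \<Sum>b=1..k. (real a - real b)\<^sup>2 - 2 * ?M * \<bar>real a - real b\<bar> + ?M\<^sup>2
       + 2 * (\<bar>real a - real b\<bar> * ?u b) - 2 * (\<bar>real a - real b\<bar> * ?u a)
       - 2 * ?M * ?u b + 2 * ?M * ?u a + (?u b)\<^sup>2 + (?u a)\<^sup>2 - 2 * (?u a * ?u b))"
    by simp
  \<comment> \<open>By symmetry in \<open>a\<close> and \<open>b\<close>, the products of the
    distance with \<open>?u b\<close> and \<open>?u a\<close> cancel, as do the terms linear in
    \<open>?u\<close>. The two pure squares of \<open>?u\<close> add up.\<close>
  also have "\<dots> = (\<Sum>a=1..k. \<Sum>b=1..k. (real a - real b)\<^sup>2) - 2 * ?M * (?K\<^sup>2 * ?M) + ?K\<^sup>2 * ?M\<^sup>2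
      + 2 * ?K * (\<Sum>a=1..k. (?u a)\<^sup>2) - 2 * (?K * ?M)\<^sup>2"
    unfolding sum.distrib sum_subtractf sum_distrib_left[symmetric] cross_a cross_b sum_sum_abs_diff[OF assms] sum_constant
      sum_mean_dist[OF assms]
    unfolding sum_distrib_right[symmetric] sum_mean_dist[OF assms]
    by (simp add: power2_eq_square)
  also have "\<dots> = ?K\<^sup>2 * Vstar k"
    using assms unfolding sq sum_real_powers sum_mean_dist_square[OF assms]
    by (simp add: mean_gap_def Vstar_def field_simps power2_eq_square)
  finally show ?thesis .
qed

section \<open>The perimeter kernel over the uniform alphabet\<close>

lemma integral_uniform_int:
  fixes f :: "int \<Rightarrow> real"
  assumes "k > 0"
  shows "(\<integral>a. f a \<partial>measure_pmf (pmf_of_set {1..int k})) = (\<Sum>j=1..k. f (int j)) / real k"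
proof -
  have "(\<Sum>a\<in>{1..int k}. f a) = (\<Sum>j=1..k. f (int j))"
    by (rule sum.reindex_bij_witness[where i=int and j=nat]) auto
  with assms show ?thesis
    by (subst integral_pmf_of_set) auto
qed

theorem theorem5p2:
  fixes P :: "'a measure" and x :: "nat \<Rightarrow> 'a \<Rightarrow> int" and k :: nat
  assumes "prob_space P"
    and "k \<ge> 2"
    and "prob_space.indep_vars P (\<lambda>_. count_space UNIV) x UNIV"
    and "\<And>i. distr P (count_space UNIV) (x i) = measure_pmf (pmf_of_set {1..int k})"
  shows "let M = integral\<^sup>L P (gap x 1); \<sigma> = sqrt (Vstar k) in
    (\<forall>i\<ge>1. integral\<^sup>L P (gap x i) = M) \<and>
    M = (real k - 1) * (real k + 1) / (3 * real k) \<and>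
    weak_conv_m
      (\<lambda>m. distr P borel (\<lambda>\<omega>. (gap_sum x m \<omega> - real m * M) / (\<sigma> * sqrt (real m))))
      std_normal_distribution"
proof -
  let ?D = "measure_pmf (pmf_of_set {1..int k})"
  have k: "k > 0" using assms(2) by simp
  interpret iid_process P "count_space UNIV" ?D x
    using assms(1,3,4) unfolding iid_process_def iid_process_axioms_def by blast
  have "AE a in ?D. a \<in> {1..int k}"
    using k by (auto simp: AE_measure_pmf_iff)
  then have "AE \<omega> in P. x i \<omega> \<in> {1..int k}" for i
    unfolding law[of i, symmetric] by (subst (asm) AE_distr_iff) auto
  \<comment> \<open>Letters are integers that lie in the alphabet only almost surely; countably many
    null sets merge into one, so that whole paths can be treated at once.\<close>
  then have range: "AE \<omega> in P. \<forall>i. x i \<omega> \<in> {1..int k}"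
    by (simp add: AE_all_countable)

  \<comment> \<open>Clamping to the alphabet, so that the kernel is bounded on all integers.\<close>
  define c where "c a = max 1 (min (int k) a)" for a
  have c_in: "c a \<in> {1..int k}" for a
    using k by (auto simp: c_def)
  have c_id: "c a = a" if "a \<in> {1..int k}" for a
    using that by (auto simp: c_def)
  have c_nat: "\<exists>n\<in>{1..k}. c a = int n" for a
    using c_in[of a] by (intro bexI[of _ "nat (c a)"]) auto
  \<comment> \<open>\<open>mean_dist\<close> replaces the function g of the overview: the two differ
    by the constant M, which cancels in the difference.\<close>
  define H where "H p q = \<bar>real_of_int p - real_of_int q\<bar> - mean_gap k
    + mean_dist k (real_of_int q) - mean_dist k (real_of_int p)" for p q
  define h where "h a b = H (c a) (c b)" for a b
  have "bounded ((\<lambda>(p, q). H p q) ` ({1..int k} \<times> {1..int k}))"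
    by (intro finite_imp_bounded finite_imageI) auto
  then obtain B where "\<bar>H p q\<bar> \<le> B" if "p \<in> {1..int k}" "q \<in> {1..int k}" for p q
    unfolding bounded_iff by fastforce
  then have h_bound: "\<bar>h a b\<bar> \<le> B" for a b
    unfolding h_def using c_in by blast
  have h_centred: "(\<integral>b. h a b \<partial>?D) = 0" for a
  proof -
    obtain n where n: "n \<in> {1..k}" "c a = int n" using c_nat by blast
    \<comment> \<open>The distances sum to \<open>k\<close> times
      \<open>mean_dist k (real n)\<close> and the values \<open>mean_dist k (real j)\<close> to
      \<open>k * mean_gap k\<close>; each cancels against one of the subtracted terms.\<close>
    have "(\<Sum>j=1..k. h a (int j)) = (\<Sum>j=1..k. \<bar>real n - real j\<bar> - mean_gap k
      + mean_dist k (real j) - mean_dist k (real n))"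
      by (intro sum.cong) (auto simp: h_def H_def n c_id)
    also have "\<dots> = 0"
      using k by (simp add: sum.distrib sum_subtractf sum_abs_diff_mean_dist[OF n(1), simplified] sum_mean_dist[OF k, simplified])
    finally show ?thesis by (simp add: integral_uniform_int[OF k])
  qed
  interpret centred_kernel P "count_space UNIV" ?D x h B
    by unfold_locales (use h_bound h_centred in \<open>auto simp: pair_measure_countable\<close>)
  have "kernel_var = (\<Sum>a=1..k. \<Sum>b=1..k. (h (int a) (int b))\<^sup>2) / (real k)\<^sup>2"
    unfolding kernel_var_def cond_var_def integral_uniform_int[OF k]
    by (simp add: sum_divide_distrib power2_eq_square)
  also have "(\<Sum>a=1..k. \<Sum>b=1..k. (h (int a) (int b))\<^sup>2) = (real k)\<^sup>2 * Vstar k"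
    unfolding variance_double_sum[OF k, symmetric]
    by (intro sum.cong) (auto simp: h_def H_def c_id)
  finally have kernel_var: "kernel_var = Vstar k" using k by simp
  \<comment> \<open>Here \<open>k \<ge> 2\<close> enters: for \<open>k = 1\<close> the variance is
    0.\<close>
  have kernel_var_pos: "kernel_var > 0"
    unfolding kernel_var Vstar_def using assms(2) by (auto intro!: divide_pos_pos mult_pos_pos add_pos_pos)

  have mean: "integral\<^sup>L P (gap x i) = mean_gap k" if "i \<ge> 1" for i
  proof -
    obtain m where i: "i = Suc m" using \<open>i \<ge> 1\<close> by (cases i) auto
    \<comment> \<open>Clamping changes nothing almost surely and provides the bound at all integers
      that \<open>expectation_pair\<close> requires.\<close>
    have "integral\<^sup>L P (gap x i) = (\<integral>\<omega>. \<bar>real_of_int (c (x m \<omega>)) - real_of_int (c (x (Suc m) \<omega>))\<bar> \<partial>P)"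
      unfolding gap_def i
      by (rule integral_cong_AE) (use range in \<open>auto elim!: eventually_mono simp: c_id abs_minus_commute\<close>)
    also have "\<dots> = (\<integral>a. (\<integral>b. \<bar>real_of_int (c a) - real_of_int (c b)\<bar> \<partial>?D) \<partial>?D)"
    proof (rule expectation_pair)
      show "norm \<bar>real_of_int (c a) - real_of_int (c b)\<bar> \<le> real k" for a b
        using c_in[of a] c_in[of b] by auto
    qed (auto simp: pair_measure_countable)
    also have "\<dots> = (\<Sum>a=1..k. \<Sum>b=1..k. \<bar>real a - real b\<bar>) / (real k)\<^sup>2"
      unfolding integral_uniform_int[OF k] by (simp add: c_id sum_divide_distrib power2_eq_square)
    finally show ?thesis using k by (simp add: sum_sum_abs_diff[OF k, simplified])
  qed

  let ?Q = "\<lambda>m \<omega>. gap_sum x m \<omega> - real m * mean_gap k"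
  have "bounded ((\<lambda>p. mean_dist k (real_of_int p)) ` {1..int k})"
    by (intro finite_imp_bounded finite_imageI) auto
  then obtain C where C: "\<bar>mean_dist k (real_of_int p)\<bar> \<le> C" if "p \<in> {1..int k}" for p
    unfolding bounded_iff by fastforce
  \<comment> \<open>On paths inside the alphabet the clamp is invisible, and the
    \<open>mean_dist\<close> differences in consecutive increments telescope to the two end
    letters.\<close>
  have telescope: "?Q m \<omega> - kernel_sum m \<omega> = mean_dist k (x 0 \<omega>) - mean_dist k (x m \<omega>)"
    if r: "\<forall>i. x i \<omega> \<in> {1..int k}" for m \<omega>
  proof -
    have h_x: "h (x i \<omega>) (x j \<omega>) = H (x i \<omega>) (x j \<omega>)" for i j
      using r by (simp add: h_def c_id)
    show ?thesis
      unfolding gap_sum_def gap_def kernel_sum_def h_x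
      by (induction m) (simp_all add: H_def abs_minus_commute algebra_simps)
  qed
  have clt: "weak_conv_m (\<lambda>m. distr P borel (\<lambda>\<omega>. ?Q m \<omega> / (sqrt kernel_var * sqrt (real m)))) std_normal_distribution"
  proof (rule clt_up_to_bounded_error[OF kernel_var_pos])
    show "?Q m \<in> borel_measurable P" for m
      unfolding gap_sum_def gap_def by measurable
    show "AE \<omega> in P. \<bar>?Q m \<omega> - kernel_sum m \<omega>\<bar> \<le> 2 * C" for m
      using range
    proof eventually_elim
      case (elim \<omega>)
      then show ?case
        unfolding telescope[OF elim] using C[of "x 0 \<omega>"] C[of "x m \<omega>"] by (auto simp: abs_le_iff)
    qed
  qed
  show ?thesis
    unfolding Let_def using mean clt by (auto simp: kernel_var mean_gap_def)
qed

end
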